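(* Let $G_A$ and $G_B$ be graphs on $n$ and $m$ vertices, with adjacency matrices $A$ and $B$, respectively. Assume that $G_A$ and $G_B$ are either both positively invertible or both negatively invertible, with (corresponding) signature matrices $D^A$ and $D^B$. Let $P$ be the lower right $k\times k$ principal submatrix of $A^{-1}$, let $R$ be the upper left $k\times k$ principal submatrix of $B^{-1}$, and let $H$ be the $n\times m$ bridging matrix. If $PR=0$ and either the matrix $D^A H D^B$ or the matrix $-D^A H D^B$ contains nonnegative integers only, then the graph $G_C=\mathcal{B}_k(G_A,G_B)$ is positively invertible (in the case when $G_A,G_B$ are both positively invertible), respectively negatively invertible (in the case when $G_A,G_B$ are both negatively invertible).
   Context: Graphs are finite and undirected, possibly with multiple edges; the adjacency matrix $A$ of a graph $G_A$ is a symmetric matrix with nonnegative integer entries, and $G_A$ denotes the graph with adjacency matrix $A$. A signature matrix is a diagonal matrix with all diagonal entries in $\{+1,-1\}$. $G_A$ is positively (respectively negatively) invertible if $A^{-1}$ exists and there is a signature matrix $D$ such that $DA^{-1}D$ is an integral matrix with all entries nonnegative (respectively nonpositive); such a $D$ is called a corresponding signature matrix. Thus $D^A A^{-1}D^A$ and $D^B B^{-1}D^B$ are both nonnegative (respectively both nonpositive). Bridging: for $1\le k\le \min(n,m)$, $\mathcal{B}_k(G_A,G_B)$ is the graph $G_C$ on $n+m$ vertices with adjacency matrix $$C=\begin{pmatrix} A & H\\ H^T & B\end{pmatrix},\qquad H=\begin{pmatrix}0&0\\ I&0\end{pmatrix},$$ where $H$ is $n\times m$ and $I$ is the $k\times k$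 identity matrix placed in the last $k$ rows and first $k$ columns of $H$; that is, the $i$-th of the last $k$ vertices of $G_A$ is joined by an edge to the $i$-th vertex of $G_B$, $i=1,\dots,k$. *)

theory Defs
  imports Complex_Main "Jordan_Normal_Form.Gauss_Jordan_Elimination"
begin

definition nonneg_integral_mat :: "real mat \<Rightarrow> bool" where
  "nonneg_integral_mat M \<longleftrightarrow>
     (\<forall>i < dim_row M. \<forall>j < dim_col M. M $$ (i,j) \<in> \<int> \<and> 0 \<le> M $$ (i,j))"

definition nonpos_integral_mat :: "real mat \<Rightarrow> bool" where
  "nonpos_integral_mat M \<longleftrightarrow>
     (\<forall>i < dim_row M. \<forall>j < dim_col M. M $$ (i,j) \<in> \<int> \<and> M $$ (i,j) \<le> 0)"

text \<open>A graph on the vertices \<open>0, \<dots>, n - 1\<close>, possibly with multiple edges, is represented by its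
  adjacency matrix. The diagonal is unconstrained, so loops are not excluded.\<close>

definition adjacency_matrix :: "nat \<Rightarrow> real mat \<Rightarrow> bool" where
  "adjacency_matrix n A \<longleftrightarrow>
     A \<in> carrier_mat n n \<and> transpose_mat A = A \<and> nonneg_integral_mat A"

definition signature_matrix :: "nat \<Rightarrow> real mat \<Rightarrow> bool" where
  "signature_matrix n D \<longleftrightarrow>
     D \<in> carrier_mat n n \<and> diagonal_mat D \<and> (\<forall>i < n. D $$ (i,i) \<in> {1, -1})"

text \<open>\<open>inverse_mat A\<close> is meaningful only if \<open>invertible_mat A\<close>; see \<open>inverse_mat\<close> below.\<close>

definition inverse_mat :: "real mat \<Rightarrow> real mat" where
  "inverse_mat A = the (mat_inverse A)"

definition pos_invertible_with :: "real mat \<Rightarrow> real mat \<Rightarrow> bool" where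
  "pos_invertible_with A D \<longleftrightarrow>
     invertible_mat A \<and> signature_matrix (dim_row A) D \<and>
     nonneg_integral_mat (D * inverse_mat A * D)"

definition neg_invertible_with :: "real mat \<Rightarrow> real mat \<Rightarrow> bool" where
  "neg_invertible_with A D \<longleftrightarrow>
     invertible_mat A \<and> signature_matrix (dim_row A) D \<and>
     nonpos_integral_mat (D * inverse_mat A * D)"

definition positively_invertible :: "real mat \<Rightarrow> bool" where
  "positively_invertible A \<longleftrightarrow> (\<exists>D. pos_invertible_with A D)"

definition negatively_invertible :: "real mat \<Rightarrow> bool" where
  "negatively_invertible A \<longleftrightarrow> (\<exists>D. neg_invertible_with A D)"

definition lower_right :: "nat \<Rightarrow> real mat \<Rightarrow> real mat" where
  "lower_right k M = mat k k (\<lambda>(i,j). M $$ (dim_row M - k + i, dim_col M - k + j))"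

definition upper_left :: "nat \<Rightarrow> real mat \<Rightarrow> real mat" where
  "upper_left k M = mat k k (\<lambda>(i,j). M $$ (i,j))"

definition bridging_matrix :: "nat \<Rightarrow> nat \<Rightarrow> nat \<Rightarrow> real mat" where
  "bridging_matrix k n m =
     four_block_mat (0\<^sub>m (n - k) k) (0\<^sub>m (n - k) (m - k))
                    (1\<^sub>m k)         (0\<^sub>m k (m - k))"

definition bridging :: "nat \<Rightarrow> real mat \<Rightarrow> real mat \<Rightarrow> real mat" where
  "bridging k A B =
     (let H = bridging_matrix k (dim_row A) (dim_row B)
      in four_block_mat A H (transpose_mat H) B)"

lemma inverse_mat:
  assumes A: "A \<in> carrier_mat n n" and inv: "invertible_mat A"
  shows "inverse_mat A \<in> carrier_mat n n"
    and "A * inverse_mat A = 1\<^sub>m n" and "inverse_mat A * A = 1\<^sub>m n"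
proof -
  from inv obtain B where AB: "A * B = 1\<^sub>m (dim_row A)" and BA: "B * A = 1\<^sub>m (dim_row B)"
    unfolding invertible_mat_def inverts_mat_def by auto
  have "dim_col B = n"
    using A arg_cong[OF AB, of dim_col] by simp
  moreover have "dim_row B = n"
    using A arg_cong[OF BA, of dim_col] by simp
  ultimately have B: "B \<in> carrier_mat n n" by auto
  have "A \<in> Units (ring_mat TYPE(real) n ())"
    unfolding Units_def ring_mat_def using A B AB BA by auto
  with mat_inverse(1)[OF A, of "()"] obtain C where C: "mat_inverse A = Some C"
    by (cases "mat_inverse A") auto
  from mat_inverse(2)[OF A C] C
  show "inverse_mat A \<in> carrier_mat n n"
    and "A * inverse_mat A = 1\<^sub>m n" and "inverse_mat A * A = 1\<^sub>m n"
    unfolding inverse_mat_def by auto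
qed

lemma bridging_matrix_carrier:
  assumes "k \<le> n" "k \<le> m"
  shows "bridging_matrix k n m \<in> carrier_mat n m"
  using assms unfolding bridging_matrix_def by (intro carrier_matI) auto

lemma bridging_matrix_index:
  assumes "k \<le> n" "k \<le> m" "i < n" "j < m"
  shows "bridging_matrix k n m $$ (i,j) = (if j < k \<and> i = n - k + j then 1 else 0)"
  using assms unfolding bridging_matrix_def by auto

lemma adjacency_matrix_bridging:
  assumes A: "adjacency_matrix n A" and B: "adjacency_matrix m B" and k: "k \<le> min n m"
  shows "adjacency_matrix (n + m) (bridging k A B)"
proof -
  let ?H = "bridging_matrix k n m"
  from A B have Ac: "A \<in> carrier_mat n n" and Bc: "B \<in> carrier_mat m m"
    and At: "transpose_mat A = A" and Bt: "transpose_mat B = B"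
    and An: "nonneg_integral_mat A" and Bn: "nonneg_integral_mat B"
    unfolding adjacency_matrix_def by auto
  have Hc: "?H \<in> carrier_mat n m" using k by (intro bridging_matrix_carrier) auto
  have C: "bridging k A B = four_block_mat A ?H (transpose_mat ?H) B"
    using Ac Bc unfolding bridging_def by (auto simp: Let_def)
  have Hn: "?H $$ (i,j) \<in> \<int> \<and> 0 \<le> ?H $$ (i,j)" if "i < n" "j < m" for i j
    using that k by (simp add: bridging_matrix_index)
  have "transpose_mat (bridging k A B) = bridging k A B"
    unfolding C using transpose_four_block_mat[OF Ac Hc _ Bc, of "transpose_mat ?H"] Hc At Bt
    by simp
  moreover have "nonneg_integral_mat (bridging k A B)"
    unfolding C nonneg_integral_mat_def
    using Ac Bc Hc An Bn Hn by (auto simp: nonneg_integral_mat_def)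
  ultimately show ?thesis
    unfolding adjacency_matrix_def C using Ac Bc by simp
qed

end

theory Submission
  imports Defs "Jordan_Normal_Form.Determinant"
begin

text \<open>
  Let \<open>X\<close> and \<open>Y\<close> be the inverses of \<open>A\<close> and \<open>B\<close>. The bridging is a perturbation
  \<open>F + N\<close> of \<open>F = diag(A, B)\<close>, whose inverse is \<open>G = diag(X, Y)\<close>, by the matrix \<open>N\<close> with
  off-diagonal blocks \<open>H\<close> and \<open>H\<^sup>T\<close>. Formally, \<open>(F + N)\<^sup>-\<^sup>1\<close> is the Neumann series
  \<open>G - GNG + GNGNG - \<dots>\<close>. The hypothesis \<open>PR = 0\<close> cuts this series off after three terms:
  factoring \<open>H = UV\<^sup>T\<close> into matrices that select the last \<open>k\<close> vertices of \<open>G\<^sub>A\<close> and the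
  first \<open>k\<close> vertices of \<open>G\<^sub>B\<close>, one has \<open>P = U\<^sup>TXU\<close> and \<open>R = V\<^sup>TYV\<close>, so that
  \<open>H\<^sup>TXHYH\<^sup>T = V(PR)U\<^sup>T = 0\<close>. This block and its transpose \<open>HYH\<^sup>TXH\<close> are the only ones
  of \<open>NGNGN\<close> that are not trivially zero (\<open>bridging_products_zero\<close>), hence \<open>NGNGN = 0\<close> and
  \<open>neumann_inverse\<close> applies.

  For the signs, put \<open>s = 1\<close> in the positive and \<open>s = -1\<close> in the negative case, and let
  \<open>e = \<plusminus>1\<close> be such that \<open>e D\<^sup>A H D\<^sup>B\<close> is nonnegative. The signature matrix
  \<open>D = diag(D\<^sup>A, -se D\<^sup>B)\<close> makes both \<open>s DGD\<close> and \<open>-s DND\<close> nonnegative. With these two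
  matrices called \<open>K\<close> and \<open>L\<close>, all signs in the conjugated series cancel, and
  \<open>s D(F + N)\<^sup>-\<^sup>1D = K + KLK + KLKLK\<close>, which is nonnegative and integral
  (\<open>signed_invertible_perturbation\<close>). Treating the two cases through the single sign \<open>s\<close> makes
  one argument serve both.
\<close>

section \<open>Matrix identities\<close>

text \<open>Stated with dimensions instead of carriers, associativity and the transpose of a product
  can be used as rewrite rules on long products: no intermediate dimension has to be guessed.\<close>

lemma mult_mat_assoc:
  fixes L M K :: "'a :: semiring_0 mat"
  assumes "dim_col L = dim_row M" "dim_col M = dim_row K"
  shows "L * M * K = L * (M * K)"
  using assms by (intro assoc_mult_mat[of _ "dim_row L" "dim_col L" _ "dim_col M" _ "dim_col K"]) auto

lemma transpose_mat_times:
  fixes L M :: "'a :: comm_semiring_0 mat"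
  assumes "dim_col L = dim_row M"
  shows "transpose_mat (L * M) = transpose_mat M * transpose_mat L"
  using assms by (intro transpose_mult[of _ "dim_row L" "dim_col L" _ "dim_col M"]) auto

lemma one_smult: "(1 :: real) \<cdot>\<^sub>m M = M" and minus_one_smult: "(- 1 :: real) \<cdot>\<^sub>m M = - M"
  by (intro eq_matI; simp)+

section \<open>Integral matrices of constant sign\<close>

lemma nonneg_integral_mat_times:
  assumes "M \<in> carrier_mat p q" "K \<in> carrier_mat q r"
    and "nonneg_integral_mat M" "nonneg_integral_mat K"
  shows "nonneg_integral_mat (M * K)"
  using assms unfolding nonneg_integral_mat_def
  by (auto simp: scalar_prod_def intro!: sum_nonneg Ints_sum mult_nonneg_nonneg Ints_mult)

lemma nonneg_integral_mat_plus:
  assumes "M \<in> carrier_mat p q" "K \<in> carrier_mat p q"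
    and "nonneg_integral_mat M" "nonneg_integral_mat K"
  shows "nonneg_integral_mat (M + K)"
  using assms unfolding nonneg_integral_mat_def by auto

lemma nonpos_integral_mat_iff: "nonpos_integral_mat M \<longleftrightarrow> nonneg_integral_mat (- 1 \<cdot>\<^sub>m M)"
  unfolding nonpos_integral_mat_def nonneg_integral_mat_def
  by (auto simp: minus_in_Ints_iff)

lemma nonneg_integral_four_block_mat:
  assumes "M1 \<in> carrier_mat p q" "M4 \<in> carrier_mat r t"
    and "M2 \<in> carrier_mat p t" "M3 \<in> carrier_mat r q"
    and "nonneg_integral_mat M1" "nonneg_integral_mat M2"
    and "nonneg_integral_mat M3" "nonneg_integral_mat M4"
  shows "nonneg_integral_mat (four_block_mat M1 M2 M3 M4)"
  using assms unfolding nonneg_integral_mat_def by auto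

lemma nonneg_integral_zero_mat: "nonneg_integral_mat (0\<^sub>m p q)"
  unfolding nonneg_integral_mat_def by auto

lemma nonneg_integral_transpose:
  "nonneg_integral_mat M \<Longrightarrow> nonneg_integral_mat (transpose_mat M)"
  unfolding nonneg_integral_mat_def by auto

section \<open>Signature matrices\<close>

lemma signature_matrix_square:
  assumes "signature_matrix p D"
  shows "D * D = 1\<^sub>m p"
proof (rule eq_matI)
  have D: "D \<in> carrier_mat p p" and diag: "\<And>i j. i < p \<Longrightarrow> j < p \<Longrightarrow> i \<noteq> j \<Longrightarrow> D $$ (i,j) = 0"
    and pm: "\<And>i. i < p \<Longrightarrow> D $$ (i,i) = 1 \<or> D $$ (i,i) = -1"
    using assms unfolding signature_matrix_def diagonal_mat_def by auto
  fix i j assume ij: "i < dim_row (1\<^sub>m p)" "j < dim_col (1\<^sub>m p)"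
  have "(D * D) $$ (i,j) = (\<Sum>l<p. D $$ (i,l) * D $$ (l,j))"
    using D ij by (auto simp: scalar_prod_def lessThan_atLeast0)
  also have "\<dots> = (\<Sum>l<p. if l = i then D $$ (i,i) * D $$ (i,j) else 0)"
    using diag ij by (intro sum.cong) auto
  also have "\<dots> = 1\<^sub>m p $$ (i,j)"
    using ij diag pm[of i] by auto
  finally show "(D * D) $$ (i,j) = 1\<^sub>m p $$ (i,j)" .
qed (use assms in \<open>auto simp: signature_matrix_def\<close>)

lemma signature_matrix_transpose:
  assumes "signature_matrix p D"
  shows "transpose_mat D = D"
  using assms unfolding signature_matrix_def diagonal_mat_def
  by (intro eq_matI) (metis carrier_matD index_transpose_mat)+

lemma signature_matrix_block:
  assumes "signature_matrix n D" "signature_matrix m E" "c = 1 \<or> c = -1"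
  shows "signature_matrix (n + m) (four_block_mat D (0\<^sub>m n m) (0\<^sub>m m n) (c \<cdot>\<^sub>m E))"
proof -
  have dims: "D \<in> carrier_mat n n" "E \<in> carrier_mat m m"
    using assms unfolding signature_matrix_def by auto
  have "four_block_mat D (0\<^sub>m n m) (0\<^sub>m m n) (c \<cdot>\<^sub>m E) $$ (i,i) \<in> {1, -1}" if i: "i < n + m" for i
  proof (cases "i < n")
    case True
    hence "D $$ (i,i) \<in> {1, -1}" using assms(1) unfolding signature_matrix_def by blast
    thus ?thesis using dims True by auto
  next
    case False
    hence "E $$ (i - n,i - n) \<in> {1, -1}" using assms(2) i unfolding signature_matrix_def by auto
    thus ?thesis using assms(3) dims False i by auto
  qed
  thus ?thesis
    using assms unfolding signature_matrix_def diagonal_mat_def by auto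
qed

text \<open>Conjugation by \<open>D\<close> distributes over products because \<open>D\<close> is its own inverse; this is what
  lets the signs of long products be read off factor by factor.\<close>

lemma signature_conj_times:
  assumes D: "signature_matrix p D" and M: "M \<in> carrier_mat p p" and K: "K \<in> carrier_mat p p"
  shows "D * (M * K) * D = (D * M * D) * (D * K * D)"
proof -
  have Dc: "D \<in> carrier_mat p p" using D unfolding signature_matrix_def by auto
  note a = mult_mat_assoc
  have "(D * M * D) * (D * K * D) = D * M * ((D * D) * (K * D))"
    using Dc M K by (simp add: a)
  also have "\<dots> = D * (M * K) * D"
    using Dc M K by (simp add: signature_matrix_square[OF D] a)
  finally show ?thesis by simp
qed

section \<open>Inverting a perturbed matrix\<close>

lemma inverse_mat_eqI:
  assumes C: "C \<in> carrier_mat p p" and Z: "Z \<in> carrier_mat p p" and CZ: "C * Z = 1\<^sub>m p"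
  shows "invertible_mat C" and "inverse_mat C = Z"
proof -
  have ZC: "Z * C = 1\<^sub>m p" by (rule mat_mult_left_right_inverse[OF C Z CZ])
  show inv: "invertible_mat C"
    unfolding invertible_mat_def inverts_mat_def using C Z CZ ZC by auto
  note I = inverse_mat[OF C inv]
  have "inverse_mat C = inverse_mat C * (C * Z)" using I(1) by (simp add: CZ)
  also have "\<dots> = (inverse_mat C * C) * Z" using assoc_mult_mat[OF I(1) C Z] by simp
  also have "\<dots> = Z" using I(3) Z by simp
  finally show "inverse_mat C = Z" .
qed

lemma inverse_mat_symmetric:
  assumes A: "A \<in> carrier_mat n n" and inv: "invertible_mat A" and At: "transpose_mat A = A"
  shows "transpose_mat (inverse_mat A) = inverse_mat A"
proof -
  note I = inverse_mat[OF A inv]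
  have "A * transpose_mat (inverse_mat A) = transpose_mat (inverse_mat A * A)"
    using transpose_mult[OF I(1) A] At by simp
  also have "\<dots> = 1\<^sub>m n" using I(3) by simp
  finally show ?thesis
    using inverse_mat_eqI(2)[OF A transpose_carrier_mat[THEN iffD2, OF I(1)]] by simp
qed

text \<open>The Neumann series of \<open>(F + N)\<^sup>-\<^sup>1\<close> around \<open>G = F\<^sup>-\<^sup>1\<close>, cut off where the hypothesis on
  \<open>N\<close> kills all later terms: with \<open>T = NG\<close>, the product is \<open>(1 - T + T\<^sup>2) + (T - T\<^sup>2 + T\<^sup>3)\<close>
  and \<open>T\<^sup>3 = 0\<close>.\<close>

lemma neumann_inverse:
  fixes F G N :: "real mat"
  assumes F: "F \<in> carrier_mat p p" and G: "G \<in> carrier_mat p p" and N: "N \<in> carrier_mat p p"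
    and FG: "F * G = 1\<^sub>m p" and nil: "N * G * N * G * N = 0\<^sub>m p p"
  shows "(F + N) * (G + - (G * N * G) + G * N * G * N * G) = 1\<^sub>m p"
proof -
  note a = mult_mat_assoc and c = mult_carrier_mat[of _ p p _ p]
  let ?T = "N * G"
  have T: "?T \<in> carrier_mat p p" using N G by simp
  have FG': "F * (G * M) = M" if "M \<in> carrier_mat p p" for M
    using that F G by (simp add: a[symmetric] FG)
  have 1: "F * (G + - (G * N * G) + G * N * G * N * G) = 1\<^sub>m p + - ?T + ?T * ?T"
    using F G N by (simp add: mult_add_distrib_mat[of _ p p _ p] assoc_add_mat[of _ p p] c a FG FG')
  have "?T * ?T * ?T = N * G * N * G * N * G" using N G by (simp add: a)
  also have "\<dots> = 0\<^sub>m p p" unfolding nil using G by simp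
  finally have T3: "?T * (?T * ?T) = 0\<^sub>m p p" using T by (simp add: a)
  have 2: "N * (G + - (G * N * G) + G * N * G * N * G) = ?T + - (?T * ?T) + ?T * (?T * ?T)"
    using G N by (simp add: mult_add_distrib_mat[of _ p p _ p] assoc_add_mat[of _ p p] c a)
  have "(F + N) * (G + - (G * N * G) + G * N * G * N * G)
      = (1\<^sub>m p + - ?T + ?T * ?T) + (?T + - (?T * ?T) + ?T * (?T * ?T))"
    unfolding 1[symmetric] 2[symmetric]
    using F G N by (intro add_mult_distrib_mat[of _ p p _ _ p]) auto
  also have "\<dots> = 1\<^sub>m p"
    unfolding T3 using N G by (intro eq_matI) (auto simp del: index_mult_mat(1))
  finally show ?thesis .
qed

text \<open>The perturbation has to carry the sign opposite to that of the inverse: then the minus sign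
  of the middle term of the series is compensated, and in every term the number of factors \<open>s\<close>
  is odd.\<close>

lemma signed_invertible_perturbation:
  fixes F G N D :: "real mat" and s :: real
  assumes F: "F \<in> carrier_mat p p" and G: "G \<in> carrier_mat p p" and N: "N \<in> carrier_mat p p"
    and FG: "F * G = 1\<^sub>m p" and nil: "N * G * N * G * N = 0\<^sub>m p p"
    and D: "signature_matrix p D" and s: "s = 1 \<or> s = -1"
    and posG: "nonneg_integral_mat (s \<cdot>\<^sub>m (D * G * D))"
    and posN: "nonneg_integral_mat (- s \<cdot>\<^sub>m (D * N * D))"
  shows "invertible_mat (F + N)"
    and "nonneg_integral_mat (s \<cdot>\<^sub>m (D * inverse_mat (F + N) * D))"
proof -
  let ?Z = "G + - (G * N * G) + G * N * G * N * G"
  have Z: "?Z \<in> carrier_mat p p" and C: "F + N \<in> carrier_mat p p" using F G N by auto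
  note inv = inverse_mat_eqI[OF C Z neumann_inverse[OF F G N FG nil]]
  show "invertible_mat (F + N)" by (rule inv(1))
  have Dc: "D \<in> carrier_mat p p" using D unfolding signature_matrix_def by auto
  note a = mult_mat_assoc and c = mult_carrier_mat[of _ p p _ p]
  define X where "X = s \<cdot>\<^sub>m (D * G * D)"
  define Y where "Y = - s \<cdot>\<^sub>m (D * N * D)"
  have Xc: "X \<in> carrier_mat p p" and Yc: "Y \<in> carrier_mat p p"
    unfolding X_def Y_def using Dc G N by auto
  have GNG: "D * (G * N * G) * D = (D * G * D) * (D * N * D) * (D * G * D)"
    and GNGNG: "D * (G * N * G * N * G) * D
      = (D * G * D) * (D * N * D) * (D * G * D) * (D * N * D) * (D * G * D)"
    using G N by (simp_all only: signature_conj_times[OF D] c)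
  have "D * ?Z * D = D * G * D + - (D * (G * N * G) * D) + D * (G * N * G * N * G) * D"
    using Dc G N by (simp add: mult_add_distrib_mat[of _ p p _ p]
        add_mult_distrib_mat[of _ p p _ _ p] assoc_add_mat[of _ p p] c a)
  also have "\<dots> = s \<cdot>\<^sub>m (X + X * Y * X + X * Y * X * Y * X)"
    using s
  proof
    assume "s = 1"
    hence "D * G * D = X" "D * N * D = - Y" unfolding X_def Y_def by (intro eq_matI; simp)+
    thus ?thesis unfolding GNG GNGNG using Xc Yc \<open>s = 1\<close>
      by (intro eq_matI) (auto simp: c a simp del: index_mult_mat(1))
  next
    assume "s = -1"
    hence "D * G * D = - X" "D * N * D = Y" unfolding X_def Y_def by (intro eq_matI; simp)+
    thus ?thesis unfolding GNG GNGNG using Xc Yc \<open>s = -1\<close>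
      by (intro eq_matI) (auto simp: c a simp del: index_mult_mat(1))
  qed
  finally have "s \<cdot>\<^sub>m (D * ?Z * D) = X + X * Y * X + X * Y * X * Y * X"
    using s Xc Yc by (auto intro!: eq_matI simp del: index_mult_mat(1))
  moreover have "nonneg_integral_mat (X + X * Y * X + X * Y * X * Y * X)"
    using Xc Yc posG[folded X_def] posN[folded Y_def]
    by (intro nonneg_integral_mat_plus[of _ p p] nonneg_integral_mat_times[of _ p p _ p]) auto
  ultimately show "nonneg_integral_mat (s \<cdot>\<^sub>m (D * inverse_mat (F + N) * D))"
    by (simp add: inv(2))
qed

section \<open>The bridging matrix\<close>

text \<open>Column \<open>j\<close> is the unit vector with index \<open>f j\<close>, so multiplication by selection matrices
  picks out rows and columns.\<close>

definition selection_mat :: "nat \<Rightarrow> nat \<Rightarrow> (nat \<Rightarrow> nat) \<Rightarrow> real mat" where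
  "selection_mat n k f = mat n k (\<lambda>(i,j). if i = f j then 1 else 0)"

lemma selection_mat_carrier [simp]: "selection_mat n k f \<in> carrier_mat n k"
  unfolding selection_mat_def by simp

lemma selection_mat_submatrix:
  assumes M: "M \<in> carrier_mat n m" and f: "\<And>i. i < k \<Longrightarrow> f i < n" and g: "\<And>j. j < l \<Longrightarrow> g j < m"
  shows "transpose_mat (selection_mat n k f) * (M * selection_mat m l g)
    = mat k l (\<lambda>(i,j). M $$ (f i, g j))"
proof (rule eq_matI)
  have Mg: "(M * selection_mat m l g) $$ (i,j) = M $$ (i, g j)" if "i < n" "j < l" for i j
    using that M g
    by (simp add: selection_mat_def scalar_prod_def if_distrib[of "\<lambda>x. _ * x"] cong: if_cong)
  fix i j assume "i < dim_row (mat k l (\<lambda>(i,j). M $$ (f i, g j)))"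
    "j < dim_col (mat k l (\<lambda>(i,j). M $$ (f i, g j)))"
  hence ij: "i < k" "j < l" by auto
  have "(transpose_mat (selection_mat n k f) * (M * selection_mat m l g)) $$ (i,j)
      = (\<Sum>r<n. (if r = f i then 1 else 0) * (M * selection_mat m l g) $$ (r,j))"
    using ij M by (simp add: selection_mat_def) (simp add: scalar_prod_def lessThan_atLeast0)
  also have "\<dots> = (\<Sum>r<n. if r = f i then M $$ (r, g j) else 0)"
    using ij Mg by (intro sum.cong) auto
  also have "\<dots> = M $$ (f i, g j)" using f[OF ij(1)] by simp
  finally show "(transpose_mat (selection_mat n k f) * (M * selection_mat m l g)) $$ (i,j)
      = mat k l (\<lambda>(i,j). M $$ (f i, g j)) $$ (i,j)" using ij by simp
qed (auto simp: selection_mat_def)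

lemma bridging_matrix_selection:
  assumes "k \<le> n" "k \<le> m"
  shows "bridging_matrix k n m
    = selection_mat n k (\<lambda>j. n - k + j) * transpose_mat (selection_mat m k (\<lambda>j. j))"
proof (rule eq_matI)
  let ?K = "selection_mat n k (\<lambda>j. n - k + j) * transpose_mat (selection_mat m k (\<lambda>j. j))"
  fix i j assume "i < dim_row ?K" "j < dim_col ?K"
  hence ij: "i < n" "j < m" by (auto simp: selection_mat_def)
  have "?K $$ (i,j) = (\<Sum>l<k. (if i = n - k + l then 1 else 0) * (if j = l then 1 else 0))"
    using ij by (simp add: selection_mat_def scalar_prod_def lessThan_atLeast0)
  also have "\<dots> = (\<Sum>l<k. if l = j then (if i = n - k + j then 1 else 0) else 0)"
    by (intro sum.cong) auto
  also have "\<dots> = bridging_matrix k n m $$ (i,j)"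
    using assms ij by (simp add: bridging_matrix_index)
  finally show "bridging_matrix k n m $$ (i,j) = ?K $$ (i,j)" by simp
qed (use bridging_matrix_carrier[OF assms] in \<open>auto simp: selection_mat_def\<close>)

text \<open>The factorisation of \<open>H\<close> through selection matrices exposes \<open>PR\<close> inside the first
  product. The second product is the transpose of the first, since \<open>X\<close> and \<open>Y\<close> are symmetric.\<close>

lemma bridging_products_zero:
  assumes k: "k \<le> n" "k \<le> m"
    and X: "X \<in> carrier_mat n n" and Y: "Y \<in> carrier_mat m m"
    and Xt: "transpose_mat X = X" and Yt: "transpose_mat Y = Y"
    and PR: "lower_right k X * upper_left k Y = 0\<^sub>m k k"
  defines "H \<equiv> bridging_matrix k n m"
  shows "transpose_mat H * X * H * Y * transpose_mat H = 0\<^sub>m m n"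
    and "H * Y * transpose_mat H * X * H = 0\<^sub>m n m"
proof -
  define U where "U = selection_mat n k (\<lambda>j. n - k + j)"
  define V where "V = selection_mat m k (\<lambda>j. j)"
  have U: "U \<in> carrier_mat n k" "transpose_mat U \<in> carrier_mat k n"
    and V: "V \<in> carrier_mat m k" "transpose_mat V \<in> carrier_mat k m"
    unfolding U_def V_def by auto
  have H: "H = U * transpose_mat V"
    unfolding H_def U_def V_def by (rule bridging_matrix_selection[OF k])
  have Ht: "transpose_mat H = V * transpose_mat U"
    unfolding H using transpose_mult[OF U(1) V(2)] by simp
  have P: "transpose_mat U * (X * U) = lower_right k X"
    unfolding U_def lower_right_def using X k by (subst selection_mat_submatrix[OF X]) auto
  have R: "transpose_mat V * (Y * V) = upper_left k Y"
    unfolding V_def upper_left_def using Y k by (subst selection_mat_submatrix[OF Y]) auto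
  have Hc: "H \<in> carrier_mat n m" unfolding H using U V by simp
  have "transpose_mat H * X * H * Y * transpose_mat H
      = V * ((transpose_mat U * (X * U)) * (transpose_mat V * (Y * V))) * transpose_mat U"
    unfolding Ht H using U V X Y by (simp add: transpose_mult[OF U(1) V(2)] mult_mat_assoc)
  also have "\<dots> = 0\<^sub>m m n" unfolding P R PR using U V by simp
  finally show 1: "transpose_mat H * X * H * Y * transpose_mat H = 0\<^sub>m m n" .
  have "H * Y * transpose_mat H * X * H
      = transpose_mat (transpose_mat H * X * H * Y * transpose_mat H)"
    using Hc X Y Xt Yt by (simp add: transpose_mat_times mult_mat_assoc)
  thus "H * Y * transpose_mat H * X * H = 0\<^sub>m n m" unfolding 1 by simp
qed

text \<open>Both cases at once: \<open>s\<close> is the common sign of the conjugated inverses and \<open>e\<close> that of the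
  conjugated bridging matrix. All matrices of the series are computed blockwise.\<close>

lemma bridging_signed_invertible:
  fixes s :: real
  assumes A: "adjacency_matrix n A" and B: "adjacency_matrix m B" and k: "k \<le> n" "k \<le> m"
    and Ai: "invertible_mat A" and Bi: "invertible_mat B"
    and DA: "signature_matrix n DA" and DB: "signature_matrix m DB" and s: "s = 1 \<or> s = -1"
    and posA: "nonneg_integral_mat (s \<cdot>\<^sub>m (DA * inverse_mat A * DA))"
    and posB: "nonneg_integral_mat (s \<cdot>\<^sub>m (DB * inverse_mat B * DB))"
    and PR: "lower_right k (inverse_mat A) * upper_left k (inverse_mat B) = 0\<^sub>m k k"
    and e: "e = 1 \<or> e = -1"
    and posH: "nonneg_integral_mat (e \<cdot>\<^sub>m (DA * bridging_matrix k n m * DB))"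
  shows "\<exists>D. signature_matrix (n + m) D \<and> invertible_mat (bridging k A B) \<and>
    nonneg_integral_mat (s \<cdot>\<^sub>m (D * inverse_mat (bridging k A B) * D))"
proof -
  define H where "H = bridging_matrix k n m"
  let ?Ht = "transpose_mat H"
  let ?X = "inverse_mat A" and ?Y = "inverse_mat B"
  have Ac: "A \<in> carrier_mat n n" and At: "transpose_mat A = A"
    and Bc: "B \<in> carrier_mat m m" and Bt: "transpose_mat B = B"
    using A B unfolding adjacency_matrix_def by auto
  have H: "H \<in> carrier_mat n m" and Ht: "?Ht \<in> carrier_mat m n"
    unfolding H_def using bridging_matrix_carrier[OF k] by auto
  note X = inverse_mat[OF Ac Ai] and Y = inverse_mat[OF Bc Bi]
  have DAc: "DA \<in> carrier_mat n n" and DBc: "DB \<in> carrier_mat m m"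
    using DA DB unfolding signature_matrix_def by auto
  note zero = bridging_products_zero[OF k X(1) Y(1) inverse_mat_symmetric[OF Ac Ai At]
      inverse_mat_symmetric[OF Bc Bi Bt] PR, folded H_def]
  define F where "F = four_block_mat A (0\<^sub>m n m) (0\<^sub>m m n) B"
  define G where "G = four_block_mat ?X (0\<^sub>m n m) (0\<^sub>m m n) ?Y"
  define N where "N = four_block_mat (0\<^sub>m n n) H ?Ht (0\<^sub>m m m)"
  \<comment> \<open>Conjugation gives the off-diagonal blocks the factor \<open>- (s * e)\<close>, which turns their sign
      from \<open>e\<close> into \<open>-s\<close>; the diagonal blocks see its square.\<close>
  define D where "D = four_block_mat DA (0\<^sub>m n m) (0\<^sub>m m n) (- (s * e) \<cdot>\<^sub>m DB)"
  have Fc: "F \<in> carrier_mat (n + m) (n + m)" and Gc: "G \<in> carrier_mat (n + m) (n + m)"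
    and Nc: "N \<in> carrier_mat (n + m) (n + m)"
    unfolding F_def G_def N_def using Ac Bc X(1) Y(1) by auto
  have C: "bridging k A B = F + N"
    unfolding F_def N_def bridging_def H_def[symmetric] Let_def
    using Ac Bc H Ht by (simp add: add_four_block_mat[of _ n n _ m _ m] H_def)
  have FG: "F * G = 1\<^sub>m (n + m)"
    unfolding F_def G_def using Ac Bc X Y
    by (simp add: mult_four_block_mat[of _ n n _ m _ m _ _ n _ m])
  have NG: "N * G = four_block_mat (0\<^sub>m n n) (H * ?Y) (?Ht * ?X) (0\<^sub>m m m)"
    unfolding N_def G_def using X(1) Y(1) H Ht
    by (simp add: mult_four_block_mat[of _ n n _ m _ m _ _ n _ m])
  have NGN: "N * G * N = four_block_mat (H * ?Y * ?Ht) (0\<^sub>m n m) (0\<^sub>m m n) (?Ht * ?X * H)"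
    unfolding NG unfolding N_def using X(1) Y(1) H Ht
    by (simp add: mult_four_block_mat[of _ n n _ m _ m _ _ n _ m] mult_carrier_mat)
  have NGNG: "N * G * N * G = four_block_mat (H * ?Y * ?Ht * ?X) (0\<^sub>m n m) (0\<^sub>m m n) (?Ht * ?X * H * ?Y)"
    unfolding NGN unfolding G_def using X(1) Y(1) H Ht
    by (simp add: mult_four_block_mat[of _ n n _ m _ m _ _ n _ m] mult_mat_assoc
        mult_carrier_mat[of _ n m] mult_carrier_mat[of _ m n]
        mult_carrier_mat[of _ n n] mult_carrier_mat[of _ m m])
  have nil: "N * G * N * G * N = 0\<^sub>m (n + m) (n + m)"
    unfolding NGNG unfolding N_def using X(1) Y(1) H Ht zero
    by (simp add: mult_four_block_mat[of _ n n _ m _ m _ _ n _ m] mult_mat_assoc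
        mult_carrier_mat[of _ n m] mult_carrier_mat[of _ m n]
        mult_carrier_mat[of _ n n] mult_carrier_mat[of _ m m])
  have c: "- (s * e) = 1 \<or> - (s * e) = -1" using s e by auto
  have D: "signature_matrix (n + m) D"
    unfolding D_def by (rule signature_matrix_block[OF DA DB c])
  have "s \<cdot>\<^sub>m (D * G * D)
      = four_block_mat (s \<cdot>\<^sub>m (DA * ?X * DA)) (0\<^sub>m n m) (0\<^sub>m m n) (s \<cdot>\<^sub>m (DB * ?Y * DB))"
    unfolding D_def G_def using X(1) Y(1) DAc DBc s e
    by (auto simp: mult_four_block_mat[of _ n n _ m _ m _ _ n _ m] one_smult minus_one_smult
        smult_four_block_mat[of _ n n _ m _ m])
  hence posG: "nonneg_integral_mat (s \<cdot>\<^sub>m (D * G * D))"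
    using posA posB X(1) Y(1) DAc DBc
    by (auto intro!: nonneg_integral_four_block_mat[of _ n n _ m m] nonneg_integral_zero_mat)
  have "- s \<cdot>\<^sub>m (D * N * D)
      = four_block_mat (0\<^sub>m n n) (e \<cdot>\<^sub>m (DA * H * DB)) (e \<cdot>\<^sub>m (DB * ?Ht * DA)) (0\<^sub>m m m)"
    unfolding D_def N_def using H Ht DAc DBc s e
    by (auto simp: mult_four_block_mat[of _ n n _ m _ m _ _ n _ m] one_smult minus_one_smult
        smult_four_block_mat[of _ n n _ m _ m])
  moreover have "e \<cdot>\<^sub>m (DB * ?Ht * DA) = transpose_mat (e \<cdot>\<^sub>m (DA * H * DB))"
    using H DAc DBc signature_matrix_transpose[OF DA] signature_matrix_transpose[OF DB] e
    by (auto simp: one_smult minus_one_smult transpose_uminus transpose_mat_times mult_mat_assoc)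
  ultimately have posN: "nonneg_integral_mat (- s \<cdot>\<^sub>m (D * N * D))"
    using posH[folded H_def] H DAc DBc
    by (auto intro!: nonneg_integral_four_block_mat[of _ n n _ m m] nonneg_integral_zero_mat
        nonneg_integral_transpose)
  show ?thesis
    unfolding C using signed_invertible_perturbation[OF Fc Gc Nc FG nil D s posG posN] D by blast
qed

theorem theorem3:
  fixes A B DA DB :: "real mat" and n m k :: nat
  assumes "adjacency_matrix n A" and "adjacency_matrix m B"
    and "1 \<le> k" and "k \<le> min n m"
    and "(pos_invertible_with A DA \<and> pos_invertible_with B DB) \<or>
         (neg_invertible_with A DA \<and> neg_invertible_with B DB)"
    and "lower_right k (inverse_mat A) * upper_left k (inverse_mat B) = 0\<^sub>m k k"
    and "nonneg_integral_mat (DA * bridging_matrix k n m * DB) \<or>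
         nonneg_integral_mat (- (DA * bridging_matrix k n m * DB))"
  shows "(pos_invertible_with A DA \<and> pos_invertible_with B DB \<longrightarrow>
            positively_invertible (bridging k A B)) \<and>
         (neg_invertible_with A DA \<and> neg_invertible_with B DB \<longrightarrow>
            negatively_invertible (bridging k A B))"
proof -
  have A: "A \<in> carrier_mat n n" and B: "B \<in> carrier_mat m m"
    using assms(1,2) unfolding adjacency_matrix_def by auto
  have k: "k \<le> n" "k \<le> m" using assms(4) by auto
  have "- (DA * bridging_matrix k n m * DB) = - 1 \<cdot>\<^sub>m (DA * bridging_matrix k n m * DB)"
    and "DA * bridging_matrix k n m * DB = 1 \<cdot>\<^sub>m (DA * bridging_matrix k n m * DB)"
    by (intro eq_matI; simp)+
  hence "nonneg_integral_mat (1 \<cdot>\<^sub>m (DA * bridging_matrix k n m * DB)) \<or>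
      nonneg_integral_mat (- 1 \<cdot>\<^sub>m (DA * bridging_matrix k n m * DB))"
    using assms(7) by metis
  then obtain e :: real where e: "e = 1 \<or> e = -1"
    and posH: "nonneg_integral_mat (e \<cdot>\<^sub>m (DA * bridging_matrix k n m * DB))" by blast
  note main = bridging_signed_invertible[OF assms(1,2) k _ _ _ _ _ _ _ assms(6) e posH]
  have dim: "dim_row (bridging k A B) = n + m"
    using adjacency_matrix_bridging[OF assms(1,2,4)] unfolding adjacency_matrix_def by auto
  show ?thesis
  proof (intro conjI impI)
    assume "pos_invertible_with A DA \<and> pos_invertible_with B DB"
    thus "positively_invertible (bridging k A B)"
      using main[of 1, unfolded one_smult] A B dim
      unfolding positively_invertible_def pos_invertible_with_def by auto
  next
    assume "neg_invertible_with A DA \<and> neg_invertible_with B DB"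
    thus "negatively_invertible (bridging k A B)"
      using main[of "-1"] A B dim
      unfolding negatively_invertible_def neg_invertible_with_def nonpos_integral_mat_iff by auto
  qed
qed

end
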